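(* Let $A$ be a closable (not necessarily densely defined) symmetric operator in a real or complex Hilbert space $H$. The following assertions are equivalent: (i) $A$ is essentially selfadjoint; (ii) there exists $c\in\mathbb{R}$, $c\neq0$, such that $\overline{\operatorname{ran} M_{A,A}(c)}=H\times H$; (iii) there exists $c\in\mathbb{R}$, $c\neq0$, such that $G(c^{-1}A)^{\perp}\subseteq\overline{\operatorname{ran} M_{A,A}(c)}$.
   Context: A linear operator in $H$ is a (possibly unbounded) linear map from a linear subspace $\operatorname{dom}A\subseteq H$ to $H$. It is symmetric if $(Ax\,|\,y)=(x\,|\,Ay)$ for all $x,y\in\operatorname{dom}A$ (density of the domain is not required); closable if the closure of its graph is the graph of an operator (its closure $\overline{A}$); essentially selfadjoint if its closure is a (densely defined) selfadjoint operator. $G(c^{-1}A)=\{(x,c^{-1}Ax):x\in\operatorname{dom}A\}$ and $\perp$ is the orthogonal complement in $H\times H$. $M_{A,A}(c)$ is the operator in $H\times H$ with domain $\operatorname{dom}A\times\operatorname{dom}A$ given by $M_{A,A}(c)(x,y)=(cx-Ay,\;Ax+cy)$. *)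

theory Defs
  imports "HOL-Analysis.Analysis"
begin

text \<open>
  A real Hilbert space is a type of sort \<open>{real_inner, complete_space}\<close>, a complex one a type of
  sort \<open>{complex_inner, complete_space}\<close>. A complex inner product space is presented together with
  its underlying real inner product space, the real inner product being the real part of the
  complex one, so that norm and topology are those of the library; positive definiteness
  is inherited from \<open>real_inner\<close>. The inner product is linear in the first argument.
\<close>

class complex_inner = real_inner +
  fixes scaleC :: "complex \<Rightarrow> 'a \<Rightarrow> 'a" (infixr \<open>*\<^sub>C\<close> 75)
    and cinner :: "'a \<Rightarrow> 'a \<Rightarrow> complex"
  assumes scaleC_add_right: "a *\<^sub>C (x + y) = a *\<^sub>C x + a *\<^sub>C y"
    and scaleC_add_left: "(a + b) *\<^sub>C x = a *\<^sub>C x + b *\<^sub>C x"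
    and scaleC_scaleC: "a *\<^sub>C b *\<^sub>C x = (a * b) *\<^sub>C x"
    and scaleC_of_real: "complex_of_real r *\<^sub>C x = r *\<^sub>R x"
    and cinner_commute: "cinner x y = cnj (cinner y x)"
    and cinner_add_left: "cinner (x + y) z = cinner x z + cinner y z"
    and cinner_scaleC_left: "cinner (a *\<^sub>C x) y = a * cinner x y"
    and Re_cinner: "Re (cinner x y) = inner x y"

instantiation complex :: complex_inner
begin

definition scaleC_complex :: "complex \<Rightarrow> complex \<Rightarrow> complex"
  where "scaleC_complex a x = a * x"

definition cinner_complex :: "complex \<Rightarrow> complex \<Rightarrow> complex"
  where "cinner_complex x y = x * cnj y"

instance
  by standard
    (auto simp: scaleC_complex_def cinner_complex_def inner_complex_def algebra_simps scaleR_conv_of_real)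

end

text \<open>
  An operator is given by its domain \<open>D\<close> and a total function \<open>A\<close> of which only the values on \<open>D\<close>
  matter. To treat real and complex scalars alike, the notions below take the scalar
  multiplication \<open>s\<close> and the inner product \<open>ip\<close> as parameters; these are to be \<open>scaleR\<close> and \<open>inner\<close>
  or \<open>scaleC\<close> and \<open>cinner\<close>.
\<close>

definition linear_operator ::
    "('k::field \<Rightarrow> 'a::ab_group_add \<Rightarrow> 'a) \<Rightarrow> 'a set \<Rightarrow> ('a \<Rightarrow> 'a) \<Rightarrow> bool"
  where "linear_operator s D A \<longleftrightarrow>
    module.subspace s D \<and>
    (\<forall>x\<in>D. \<forall>y\<in>D. A (x + y) = A x + A y) \<and>
    (\<forall>a. \<forall>x\<in>D. A (s a x) = s a (A x))"

definition symmetric_operator ::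
    "('a \<Rightarrow> 'a \<Rightarrow> 'k) \<Rightarrow> 'a set \<Rightarrow> ('a \<Rightarrow> 'a) \<Rightarrow> bool"
  where "symmetric_operator ip D A \<longleftrightarrow> (\<forall>x\<in>D. \<forall>y\<in>D. ip (A x) y = ip x (A y))"

definition op_graph :: "'a set \<Rightarrow> ('a \<Rightarrow> 'b) \<Rightarrow> ('a \<times> 'b) set"
  where "op_graph D A = {(x, A x) | x. x \<in> D}"

definition is_operator_closure ::
    "('k::field \<Rightarrow> 'a::{ab_group_add, topological_space} \<Rightarrow> 'a) \<Rightarrow>
      'a set \<Rightarrow> ('a \<Rightarrow> 'a) \<Rightarrow> 'a set \<Rightarrow> ('a \<Rightarrow> 'a) \<Rightarrow> bool"
  where "is_operator_closure s D A E B \<longleftrightarrow>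
    linear_operator s E B \<and> op_graph E B = closure (op_graph D A)"

definition closable ::
    "('k::field \<Rightarrow> 'a::{ab_group_add, topological_space} \<Rightarrow> 'a) \<Rightarrow> 'a set \<Rightarrow> ('a \<Rightarrow> 'a) \<Rightarrow> bool"
  where "closable s D A \<longleftrightarrow> (\<exists>E B. is_operator_closure s D A E B)"

text \<open>This is the graph of an operator exactly when \<open>D\<close> is dense.\<close>

definition adjoint_graph ::
    "('a \<Rightarrow> 'a \<Rightarrow> 'k) \<Rightarrow> 'a set \<Rightarrow> ('a \<Rightarrow> 'a) \<Rightarrow> ('a \<times> 'a) set"
  where "adjoint_graph ip D A = {(y, z). \<forall>x\<in>D. ip (A x) y = ip x z}"

definition selfadjoint_operator ::
    "('a::topological_space \<Rightarrow> 'a \<Rightarrow> 'k) \<Rightarrow> 'a set \<Rightarrow> ('a \<Rightarrow> 'a) \<Rightarrow> bool"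
  where "selfadjoint_operator ip D A \<longleftrightarrow>
    closure D = UNIV \<and> op_graph D A = adjoint_graph ip D A"

definition essentially_selfadjoint ::
    "('k::field \<Rightarrow> 'a::{ab_group_add, topological_space} \<Rightarrow> 'a) \<Rightarrow> ('a \<Rightarrow> 'a \<Rightarrow> 'k) \<Rightarrow>
      'a set \<Rightarrow> ('a \<Rightarrow> 'a) \<Rightarrow> bool"
  where "essentially_selfadjoint s ip D A \<longleftrightarrow>
    (\<exists>E B. is_operator_closure s D A E B \<and> selfadjoint_operator ip E B)"

definition prod_ip :: "('a \<Rightarrow> 'a \<Rightarrow> 'k::plus) \<Rightarrow> 'a \<times> 'a \<Rightarrow> 'a \<times> 'a \<Rightarrow> 'k"
  where "prod_ip ip u v = ip (fst u) (fst v) + ip (snd u) (snd v)"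

definition ortho_compl :: "('a \<Rightarrow> 'a \<Rightarrow> 'k::{plus, zero}) \<Rightarrow> ('a \<times> 'a) set \<Rightarrow> ('a \<times> 'a) set"
  where "ortho_compl ip S = {v. \<forall>u\<in>S. prod_ip ip u v = 0}"

text \<open>
  The operator \<open>M\<^bsub>A,A\<^esub>(c)\<close>, to be considered on the domain \<open>D \<times> D\<close>. As \<open>c\<close> is real, \<open>*\<^sub>R\<close> serves for
  both scalar fields.
\<close>

definition M_op :: "('a::real_vector \<Rightarrow> 'a) \<Rightarrow> real \<Rightarrow> 'a \<times> 'a \<Rightarrow> 'a \<times> 'a"
  where "M_op A c = (\<lambda>(x, y). (c *\<^sub>R x - A y, A x + c *\<^sub>R y))"

definition ran_M :: "'a set \<Rightarrow> ('a::real_vector \<Rightarrow> 'a) \<Rightarrow> real \<Rightarrow> ('a \<times> 'a) set"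
  where "ran_M D A c = M_op A c ` (D \<times> D)"

end

theory Submission
  imports Defs
begin

text \<open>
  Passing to the closure \<open>B\<close> of \<open>A\<close> changes neither the adjoint nor symmetry, and symmetry makes
  the cross terms in the square norm of \<open>M(x, y)\<close> cancel, so that it equals
  \<open>c\<^sup>2 (|x|\<^sup>2 + |y|\<^sup>2) + |A x|\<^sup>2 + |A y|\<^sup>2\<close>; hence the closure of the range of \<open>M\<close> for \<open>A\<close> lies in
  its range for \<open>B\<close>. A pair orthogonal to the range consists of vectors \<open>u\<close>, \<open>v\<close> with
  \<open>A\<^sup>* u = c v\<close> and \<open>A\<^sup>* v = - c u\<close>, which vanishes if \<open>A\<^sup>* = B\<close> is symmetric. Conversely, if
  \<open>(v, w)\<close> is in the graph of \<open>A\<^sup>*\<close>, then \<open>(- w / c, v)\<close> is orthogonal to the graph of \<open>A / c\<close>;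
  writing it as \<open>M(x, y)\<close> for \<open>B\<close> and testing the adjoint relation with \<open>x\<close> gives
  \<open>|B x|\<^sup>2 = - c\<^sup>2 |x|\<^sup>2\<close>, so \<open>x = 0\<close> and \<open>(v, w) = (c y, c B y)\<close> is in the graph of \<open>B\<close>.
  The complex case reduces to the real one, since \<open>cinner x y\<close> is determined by the real inner
  products of \<open>x\<close> and \<open>i x\<close> with \<open>y\<close>.
\<close>

section \<open>Density of subspaces with trivial orthogonal complement\<close>

text \<open>A minimizing sequence in \<open>S\<close> for the distance to \<open>x\<close>
  converges, by completeness, to some \<open>z\<close> in \<open>closure S\<close>. Minimality makes
  \<open>x - z\<close> orthogonal to \<open>S\<close>, so \<open>x = z\<close>.\<close>

lemma dense_subspaceI:
  fixes S :: "'a::{real_inner, complete_space} set"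
  assumes S: "subspace S" and orth: "\<And>v. \<forall>u\<in>S. inner u v = 0 \<Longrightarrow> v = 0"
  shows "closure S = UNIV"
proof -
  have "x \<in> closure S" for x
  proof -
    define d where "d = infdist x S"
    have ne: "S \<noteq> {}" using subspace_0[OF S] by auto
    have d0: "0 \<le> d" by (simp add: d_def infdist_nonneg)
    have d_le: "d \<le> norm (x - s)" if "s \<in> S" for s
      using infdist_le[OF that, of x] by (simp add: d_def dist_norm)
    have "\<exists>s\<in>S. norm (x - s) < d + inverse (real (Suc n))" for n
    proof (rule ccontr)
      assume "\<not> ?thesis"
      then have "d + inverse (real (Suc n)) \<le> infdist x S"
        unfolding infdist_notempty[OF ne] by (intro cINF_greatest ne) (auto simp: dist_norm not_less)
      then show False by (simp add: d_def)
    qed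
    then obtain y where y: "\<And>n. y n \<in> S" "\<And>n. norm (x - y n) < d + inverse (real (Suc n))"
      by metis
    have lim_d: "(\<lambda>n. norm (x - y n)) \<longlonglongrightarrow> d"
    proof (rule tendsto_sandwich[where f = "\<lambda>_. d"])
      show "\<forall>\<^sub>F n in sequentially. norm (x - y n) \<le> d + inverse (real (Suc n))"
        using y(2) by (simp add: less_imp_le)
      show "(\<lambda>n. d + inverse (real (Suc n))) \<longlonglongrightarrow> d"
        using tendsto_add[OF tendsto_const LIMSEQ_inverse_real_of_nat] by simp
    qed (auto simp: d_le y(1))
    \<comment> \<open>Parallelogram law for \<open>x - y m\<close> and \<open>x - y n\<close>: the
      midpoint of \<open>y m\<close> and \<open>y n\<close> lies in \<open>S\<close>, hence at
      distance at least \<open>d\<close> from \<open>x\<close>.\<close>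
    have para: "(norm (y m - y n))\<^sup>2 \<le> 2 * (norm (x - y m))\<^sup>2 + 2 * (norm (x - y n))\<^sup>2 - 4 * d\<^sup>2" for m n
    proof -
      have "(1/2) *\<^sub>R (y m + y n) \<in> S"
        using S y(1) by (intro subspace_scale subspace_add)
      from d_le[OF this] have "d\<^sup>2 \<le> (norm (x - (1/2) *\<^sub>R (y m + y n)))\<^sup>2"
        using d0 by (intro power_mono)
      then show ?thesis
        by (simp add: power2_norm_eq_inner inner_commute algebra_simps)
    qed
    have "Cauchy y"
    proof (rule CauchyI)
      fix e :: real assume "0 < e"
      have "(\<lambda>n. (norm (x - y n))\<^sup>2) \<longlonglongrightarrow> d\<^sup>2" using lim_d by (rule tendsto_power)
      \<comment> \<open>With slack \<open>e\<^sup>2 / 4\<close> in both squares, the right-hand side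
        of \<open>para\<close> falls below \<open>e\<^sup>2\<close>.\<close>
      moreover have "d\<^sup>2 < d\<^sup>2 + e\<^sup>2 / 4" using \<open>0 < e\<close> by simp
      ultimately have "\<forall>\<^sub>F n in sequentially. (norm (x - y n))\<^sup>2 < d\<^sup>2 + e\<^sup>2 / 4"
        by (rule order_tendstoD(2))
      then obtain N where N: "\<And>n. n \<ge> N \<Longrightarrow> (norm (x - y n))\<^sup>2 < d\<^sup>2 + e\<^sup>2 / 4"
        by (auto simp: eventually_sequentially)
      have "norm (y m - y n) < e" if "m \<ge> N" "n \<ge> N" for m n
      proof (rule power2_less_imp_less)
        show "(norm (y m - y n))\<^sup>2 < e\<^sup>2"
          using para[of m n] N[OF that(1)] N[OF that(2)] by linarith
      qed (use \<open>0 < e\<close> in simp)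
      then show "\<exists>N. \<forall>m\<ge>N. \<forall>n\<ge>N. norm (y m - y n) < e" by blast
    qed
    then obtain z where z: "y \<longlonglongrightarrow> z"
      using Cauchy_convergent convergent_def by blast
    have d_eq: "norm (x - z) = d"
      using LIMSEQ_unique[OF tendsto_norm[OF tendsto_diff[OF tendsto_const z]] lim_d] .
    have "inner u (x - z) = 0" if u: "u \<in> S" for u
    proof (cases "u = 0")
      case False
      \<comment> \<open>\<open>t *\<^sub>R u\<close> is the projection of \<open>x - z\<close> onto
        the line of \<open>u\<close>. Replacing \<open>z\<close> by \<open>z + t *\<^sub>R u\<close>
        lowers the squared distance by \<open>(inner u (x - z))\<^sup>2 / inner u u\<close>, which
        minimality forces to be zero.\<close>
      define t where "t = inner u (x - z) / inner u u"
      have "(\<lambda>n. norm (x - (y n + t *\<^sub>R u))) \<longlonglongrightarrow> norm (x - (z + t *\<^sub>R u))"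
        by (intro tendsto_intros z)
      then have "d \<le> norm (x - (z + t *\<^sub>R u))"
        by (rule LIMSEQ_le_const) (use d_le S y(1) u in \<open>auto intro: subspace_add subspace_scale\<close>)
      then have "(norm (x - z))\<^sup>2 \<le> (norm ((x - z) - t *\<^sub>R u))\<^sup>2"
        unfolding d_eq[symmetric] by (simp add: diff_diff_add)
      also have "\<dots> = (norm (x - z))\<^sup>2 - 2 * (t * inner u (x - z)) + t * (t * inner u u)"
        unfolding power2_norm_eq_inner
        by (simp add: inner_commute algebra_simps)
      also have "t * inner u u = inner u (x - z)"
        using False by (simp add: t_def)
      finally have "(inner u (x - z))\<^sup>2 / inner u u \<le> 0"
        by (simp add: t_def power2_eq_square)
      then show ?thesis
        using False by (metis divide_pos_pos inner_gt_zero_iff not_less zero_less_power2)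
    qed simp
    then have "x - z = 0" by (intro orth) blast
    then show ?thesis
      using z y(1) by (auto simp: closure_sequential)
  qed
  then show ?thesis by blast
qed

section \<open>Adjoints and symmetry under closure of the graph\<close>

lemma linear_operator_real_iff:
  "linear_operator scaleR D A \<longleftrightarrow> subspace D \<and> (\<forall>x\<in>D. \<forall>y\<in>D. A (x + y) = A x + A y) \<and>
    (\<forall>a. \<forall>x\<in>D. A (a *\<^sub>R x) = a *\<^sub>R A x)"
  by (simp add: linear_operator_def module.subspace_def[OF real_vector.module_axioms] subspace_def)

lemma subspace_op_graph:
  assumes "linear_operator scaleR D A"
  shows "subspace (op_graph D A)"
proof -
  have "A 0 = 0" if "0 \<in> D"
  proof -
    have "A (0 *\<^sub>R 0) = 0 *\<^sub>R A 0" using assms that unfolding linear_operator_real_iff by blast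
    then show ?thesis by simp
  qed
  with assms show ?thesis
    unfolding linear_operator_real_iff subspace_def op_graph_def by (auto simp: zero_prod_def)
qed

lemma mem_op_graph: "(x, y) \<in> op_graph D A \<longleftrightarrow> x \<in> D \<and> y = A x"
  by (auto simp: op_graph_def)

lemma mem_adjoint_graph_iff:
  "(y, z) \<in> adjoint_graph inner D A \<longleftrightarrow> op_graph D A \<subseteq> {p. inner (snd p) y = inner (fst p) z}"
  by (auto simp: adjoint_graph_def op_graph_def)

text \<open>For fixed \<open>y\<close> and \<open>z\<close> the adjoint relation cuts out a closed
  set of pairs, so a graph lies in it exactly when its closure does.\<close>

lemma adjoint_graph_closure:
  fixes A :: "'a::real_inner \<Rightarrow> 'a"
  assumes "op_graph E B = closure (op_graph D A)"
  shows "adjoint_graph inner E B = adjoint_graph inner D A"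
proof -
  have "(y, z) \<in> adjoint_graph inner E B \<longleftrightarrow> (y, z) \<in> adjoint_graph inner D A" for y z
  proof -
    have "closed {p :: 'a \<times> 'a. inner (snd p) y = inner (fst p) z}"
      by (rule closed_Collect_eq; intro continuous_intros)
    then show ?thesis
      unfolding mem_adjoint_graph_iff assms using closure_minimal closure_subset by blast
  qed
  then show ?thesis by (simp add: set_eq_iff)
qed

lemma closed_adjoint_graph: "closed (adjoint_graph inner D A)"
proof -
  have "adjoint_graph inner D A = (\<Inter>x\<in>D. {p. inner (A x) (fst p) = inner x (snd p)})"
    by (simp add: adjoint_graph_def set_eq_iff)
  moreover have "closed {p. inner (A x) (fst p) = inner x (snd p)}" for x
    by (rule closed_Collect_eq; intro continuous_intros)
  ultimately show ?thesis by (simp add: closed_INT)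
qed

lemma symmetric_iff_graph_subset_adjoint:
  "symmetric_operator inner D A \<longleftrightarrow> op_graph D A \<subseteq> adjoint_graph inner D A"
  by (auto simp: symmetric_operator_def op_graph_def adjoint_graph_def)

text \<open>Symmetry puts the graph inside the closed adjoint graph, which then also contains the
  closure and is itself unchanged by closing.\<close>

lemma symmetric_closure:
  assumes "op_graph E B = closure (op_graph D A)" "symmetric_operator inner D A"
  shows "symmetric_operator inner E B"
  using assms closure_minimal[OF _ closed_adjoint_graph]
  unfolding symmetric_iff_graph_subset_adjoint adjoint_graph_closure[OF assms(1)] by metis

section \<open>The range of \<open>M\<close> and its closure\<close>

lemma subspace_ran_M:
  assumes "linear_operator scaleR D A"
  shows "subspace (ran_M D A c)"
proof -
  have D: "subspace D" and add: "\<And>x y. x \<in> D \<Longrightarrow> y \<in> D \<Longrightarrow> A (x + y) = A x + A y"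
    and scale: "\<And>a x. x \<in> D \<Longrightarrow> A (a *\<^sub>R x) = a *\<^sub>R A x"
    using assms unfolding linear_operator_real_iff by auto
  show ?thesis
  proof (rule subspaceI)
    have "A 0 = 0" using scale[of 0 0] subspace_0[OF D] by simp
    then have "M_op A c (0, 0) = 0" by (simp add: M_op_def zero_prod_def)
    then show "0 \<in> ran_M D A c"
      unfolding ran_M_def using subspace_0[OF D] by (metis SigmaI image_eqI)
  next
    fix p q assume "p \<in> ran_M D A c" "q \<in> ran_M D A c"
    then obtain x y x' y' where xy: "x \<in> D" "y \<in> D" "x' \<in> D" "y' \<in> D"
      and pq: "p = M_op A c (x, y)" "q = M_op A c (x', y')"
      by (auto simp: ran_M_def)
    have "p + q = M_op A c (x + x', y + y')"
      using xy by (simp add: pq M_op_def add algebra_simps)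
    then show "p + q \<in> ran_M D A c"
      using xy D by (auto simp: ran_M_def intro!: subspace_add)
  next
    fix a p assume "p \<in> ran_M D A c"
    then obtain x y where xy: "x \<in> D" "y \<in> D" and p: "p = M_op A c (x, y)"
      by (auto simp: ran_M_def)
    have "a *\<^sub>R p = M_op A c (a *\<^sub>R x, a *\<^sub>R y)"
      using xy by (simp add: p M_op_def scale algebra_simps)
    then show "a *\<^sub>R p \<in> ran_M D A c"
      using xy D by (auto simp: ran_M_def intro!: subspace_scale)
  qed
qed

text \<open>On pairs of points of the complete graph of \<open>B\<close>, \<open>M\<close> acts as a
  bounded linear map that is bounded below, so its image is closed.\<close>

lemma closure_ran_M_subset:
  fixes D :: "'a::{real_inner, complete_space} set"
  assumes cl: "is_operator_closure scaleR D A E B" and sym: "symmetric_operator inner D A"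
    and c: "c \<noteq> 0"
  shows "closure (ran_M D A c) \<subseteq> ran_M E B c"
proof -
  \<comment> \<open>\<open>f\<close> computes \<open>M\<close> from
    \<open>((x, A x), (y, A y))\<close>; with the values of \<open>A\<close> as coordinates, it is
    bounded even if \<open>A\<close> is not.\<close>
  define f :: "('a \<times> 'a) \<times> 'a \<times> 'a \<Rightarrow> 'a \<times> 'a" where
    "f = (\<lambda>p. (c *\<^sub>R fst (fst p) - snd (snd p), snd (fst p) + c *\<^sub>R fst (snd p)))"
  have lin: "linear_operator scaleR E B" and gr: "op_graph E B = closure (op_graph D A)"
    using cl by (auto simp: is_operator_closure_def)
  have symB: "symmetric_operator inner E B" by (rule symmetric_closure[OF gr sym])
  have f_image: "f ` (op_graph D' A' \<times> op_graph D' A') = ran_M D' A' c" for D' A'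
    by (force simp: f_def ran_M_def op_graph_def M_op_def image_iff)
  \<comment> \<open>The squared norm of \<open>f p\<close> has coefficients \<open>1\<close> and
    \<open>c\<^sup>2\<close>; \<open>e\<^sup>2\<close> is below both.\<close>
  define e where "e = min 1 \<bar>c\<bar>"
  have "complete (f ` (op_graph E B \<times> op_graph E B))"
  proof (rule complete_isometric_image)
    show "0 < e" using c by (simp add: e_def)
    show "subspace (op_graph E B \<times> op_graph E B)"
      by (intro subspace_Times subspace_op_graph lin)
    show "bounded_linear f"
      unfolding f_def
      by (intro bounded_linear_Pair bounded_linear_sub bounded_linear_add
          bounded_linear_compose[OF bounded_linear_scaleR_right]
          bounded_linear_compose[OF bounded_linear_fst] bounded_linear_compose[OF bounded_linear_snd]
          bounded_linear_fst bounded_linear_snd)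
    show "complete (op_graph E B \<times> op_graph E B)"
      by (simp add: gr complete_eq_closed closed_Times)
    show "\<forall>p\<in>op_graph E B \<times> op_graph E B. e * norm p \<le> norm (f p)"
    proof
      fix p assume "p \<in> op_graph E B \<times> op_graph E B"
      then obtain x y where xy: "x \<in> E" "y \<in> E" and p: "p = ((x, B x), (y, B y))"
        by (auto simp: op_graph_def)
      have s: "inner (B x) y = inner x (B y)"
        using symB xy by (simp add: symmetric_operator_def)
      have e2: "e\<^sup>2 \<le> 1" "e\<^sup>2 \<le> c\<^sup>2"
        using c by (auto simp: e_def power_le_one abs_le_square_iff[symmetric])
      have n4: "e\<^sup>2 * (norm p)\<^sup>2 = e\<^sup>2 * (norm x)\<^sup>2 + e\<^sup>2 * (norm (B x))\<^sup>2
          + e\<^sup>2 * (norm y)\<^sup>2 + e\<^sup>2 * (norm (B y))\<^sup>2"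
        by (simp add: p power2_norm_eq_inner inner_prod_def algebra_simps)
      have "(norm (f p))\<^sup>2 = c\<^sup>2 * (norm x)\<^sup>2 + 1 * (norm (B x))\<^sup>2 + c\<^sup>2 * (norm y)\<^sup>2 + 1 * (norm (B y))\<^sup>2"
        using s unfolding power2_norm_eq_inner
        by (simp add: f_def p inner_prod_def inner_commute power2_eq_square algebra_simps)
      also have "\<dots> \<ge> e\<^sup>2 * (norm p)\<^sup>2"
        unfolding n4 by (intro add_mono mult_right_mono e2) auto
      finally have "(e * norm p)\<^sup>2 \<le> (norm (f p))\<^sup>2" by (simp add: power_mult_distrib)
      then show "e * norm p \<le> norm (f p)" by (rule power2_le_imp_le) simp
    qed
  qed
  then have "closed (ran_M E B c)" by (simp add: f_image complete_eq_closed)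
  moreover have "ran_M D A c \<subseteq> ran_M E B c"
    unfolding f_image[symmetric] gr by (intro image_mono Sigma_mono closure_subset)
  ultimately show ?thesis by (rule closure_minimal[rotated])
qed

section \<open>The equivalences over real scalars\<close>

lemma selfadjoint_imp_dense_ran_M:
  fixes D :: "'a::{real_inner, complete_space} set"
  assumes lin: "linear_operator scaleR D A" and ess: "essentially_selfadjoint scaleR inner D A"
    and sym: "symmetric_operator inner D A" and c: "c \<noteq> 0"
  shows "closure (ran_M D A c) = UNIV"
proof (rule dense_subspaceI[OF subspace_ran_M[OF lin]])
  fix p assume p: "\<forall>q\<in>ran_M D A c. inner q p = 0"
  obtain E B where gr: "op_graph E B = closure (op_graph D A)"
    and sa: "op_graph E B = adjoint_graph inner E B"
    using ess by (auto simp: essentially_selfadjoint_def is_operator_closure_def selfadjoint_operator_def)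
  obtain u v where uv: "p = (u, v)" by (cases p)
  have D: "0 \<in> D" "A 0 = 0"
    using subspace_0[OF subspace_op_graph[OF lin]] by (auto simp: zero_prod_def mem_op_graph)
  have orth: "inner (c *\<^sub>R x - A y) u + inner (A x + c *\<^sub>R y) v = 0" if "x \<in> D" "y \<in> D" for x y
    using p that by (force simp: ran_M_def M_op_def uv inner_prod_def)
  \<comment> \<open>The two memberships come from testing orthogonality with \<open>y = 0\<close>
    and with \<open>x = 0\<close>.\<close>
  have "(v, - c *\<^sub>R u) \<in> adjoint_graph inner D A" "(u, c *\<^sub>R v) \<in> adjoint_graph inner D A"
    using orth[OF _ D(1)] orth[OF D(1)]
    by (auto simp: adjoint_graph_def D algebra_simps)
       (metis add.commute add_eq_0_iff)+
  then have "v \<in> E" "B v = - c *\<^sub>R u" "u \<in> E" "B u = c *\<^sub>R v"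
    unfolding adjoint_graph_closure[OF gr, symmetric] sa[symmetric] mem_op_graph by auto
  moreover have "symmetric_operator inner E B" by (rule symmetric_closure[OF gr sym])
  ultimately have "inner (c *\<^sub>R v) v = inner u (- c *\<^sub>R u)"
    unfolding symmetric_operator_def by metis
  then have "c * (inner u u + inner v v) = 0" by (simp add: algebra_simps)
  then show "p = 0"
    using c by (simp add: uv zero_prod_def add_nonneg_eq_0_iff)
qed

lemma orthogonal_graph_in_ran_M_imp_selfadjoint:
  fixes D :: "'a::{real_inner, complete_space} set"
  assumes clos: "closable scaleR D A" and sym: "symmetric_operator inner D A" and c: "c \<noteq> 0"
    and sub: "ortho_compl inner (op_graph D (\<lambda>x. inverse c *\<^sub>R A x)) \<subseteq> closure (ran_M D A c)"
  shows "essentially_selfadjoint scaleR inner D A"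
proof -
  obtain E B where cl: "is_operator_closure scaleR D A E B"
    using clos by (auto simp: closable_def)
  then have lin: "linear_operator scaleR E B" and gr: "op_graph E B = closure (op_graph D A)"
    by (auto simp: is_operator_closure_def)
  have symB: "symmetric_operator inner E B" by (rule symmetric_closure[OF gr sym])
  have E: "subspace E" and B_scale: "\<And>a x. x \<in> E \<Longrightarrow> B (a *\<^sub>R x) = a *\<^sub>R B x"
    using lin unfolding linear_operator_real_iff by auto
  have B0: "B 0 = 0" using B_scale[of 0 0] subspace_0[OF E] by simp
  have adj: "adjoint_graph inner E B \<subseteq> op_graph E B"
  proof clarify
    fix v w assume vw: "(v, w) \<in> adjoint_graph inner E B"
    then have "(v, w) \<in> adjoint_graph inner D A" by (simp add: adjoint_graph_closure[OF gr])
    then have "(- inverse c *\<^sub>R w, v) \<in> ortho_compl inner (op_graph D (\<lambda>x. inverse c *\<^sub>R A x))"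
      by (auto simp: ortho_compl_def prod_ip_def op_graph_def adjoint_graph_def)
    then have "(- inverse c *\<^sub>R w, v) \<in> ran_M E B c"
      using sub closure_ran_M_subset[OF cl sym c] by blast
    then obtain x y where xy: "x \<in> E" "y \<in> E" and w': "- inverse c *\<^sub>R w = c *\<^sub>R x - B y"
      and v: "v = B x + c *\<^sub>R y"
      by (auto simp: ran_M_def M_op_def)
    have w: "w = - c *\<^sub>R (c *\<^sub>R x - B y)" using c by (simp flip: w')
    \<comment> \<open>After inserting \<open>v\<close> and \<open>w\<close>, the terms
      \<open>c * inner (B x) y\<close> and \<open>c * inner x (B y)\<close> cancel by symmetry,
      leaving a sum of nonnegative terms equal to zero.\<close>
    have "inner (B x) v = inner x w"
      using vw xy by (simp add: adjoint_graph_def)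
    moreover have "inner (B x) y = inner x (B y)"
      using symB xy by (simp add: symmetric_operator_def)
    ultimately have "inner (B x) (B x) + c\<^sup>2 * inner x x = 0"
      by (simp add: v w power2_eq_square algebra_simps)
    then have "c\<^sup>2 * inner x x = 0"
      by (smt (verit) inner_ge_zero mult_nonneg_nonneg zero_le_power2)
    then have "x = 0" using c by simp
    then show "(v, w) \<in> op_graph E B"
      using xy E by (simp add: v w B0 mem_op_graph B_scale subspace_scale)
  qed
  \<comment> \<open>Density is derived: a vector \<open>w\<close> orthogonal to \<open>E\<close>
    gives \<open>(0, w)\<close> in the adjoint graph, hence in the graph of \<open>B\<close>, so
    \<open>w = B 0 = 0\<close>.\<close>
  have "closure E = UNIV"
  proof (rule dense_subspaceI[OF E])
    fix w assume "\<forall>u\<in>E. inner u w = 0"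
    then have "(0, w) \<in> adjoint_graph inner E B" by (simp add: adjoint_graph_def)
    with adj show "w = 0" by (auto simp: mem_op_graph B0)
  qed
  then have "selfadjoint_operator inner E B"
    using adj symB unfolding selfadjoint_operator_def symmetric_iff_graph_subset_adjoint by blast
  with cl show ?thesis unfolding essentially_selfadjoint_def by blast
qed

lemma theorem3p3_real:
  fixes D :: "'a::{real_inner, complete_space} set"
  assumes "linear_operator scaleR D A" "closable scaleR D A" "symmetric_operator inner D A"
  shows "essentially_selfadjoint scaleR inner D A \<longleftrightarrow>
      (\<exists>c::real. c \<noteq> 0 \<and> closure (ran_M D A c) = UNIV)" (is "?i \<longleftrightarrow> ?ii")
    and "essentially_selfadjoint scaleR inner D A \<longleftrightarrow>
      (\<exists>c::real. c \<noteq> 0 \<and>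
        ortho_compl inner (op_graph D (\<lambda>x. inverse c *\<^sub>R A x)) \<subseteq> closure (ran_M D A c))"
      (is "_ \<longleftrightarrow> ?iii")
proof -
  \<comment> \<open>Density holds for every nonzero \<open>c\<close>, so \<open>1\<close> can serve
    as witness.\<close>
  have "?i \<Longrightarrow> ?ii"
    using selfadjoint_imp_dense_ran_M[OF assms(1) _ assms(3)] zero_neq_one by metis
  moreover have "?ii \<Longrightarrow> ?iii" by auto
  moreover have "?iii \<Longrightarrow> ?i"
    using orthogonal_graph_in_ran_M_imp_selfadjoint[OF assms(2,3)] by blast
  ultimately show "?i \<longleftrightarrow> ?ii" "?i \<longleftrightarrow> ?iii" by blast+
qed

section \<open>Reduction of complex to real scalars\<close>

lemma module_scaleC: "module (scaleC :: complex \<Rightarrow> 'a \<Rightarrow> 'a::complex_inner)"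
proof
  show "1 *\<^sub>C x = x" for x :: 'a
    using scaleC_of_real[of 1 x] by simp
qed (simp_all add: scaleC_add_left scaleC_add_right scaleC_scaleC)

lemma linear_operator_complex_imp_real:
  assumes "linear_operator scaleC D A"
  shows "linear_operator scaleR D A"
  using assms
  unfolding linear_operator_real_iff
  unfolding linear_operator_def module.subspace_def[OF module_scaleC] subspace_def
  by (simp flip: scaleC_of_real)

lemma linear_operator_scaleC:
  assumes "linear_operator scaleC D A" "x \<in> D"
  shows "a *\<^sub>C x \<in> D" "A (a *\<^sub>C x) = a *\<^sub>C A x"
  using assms unfolding linear_operator_def module.subspace_def[OF module_scaleC] by auto

text \<open>The imaginary part of a complex number is minus the real part of its product with
  \<open>\<i>\<close>, which linearity moves into the first argument.\<close>

lemma cinner_eq_Complex: "cinner x y = Complex (inner x y) (- inner (\<i> *\<^sub>C x) y)"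
  by (rule complex_eqI) (simp_all add: Re_cinner flip: Re_cinner[of "\<i> *\<^sub>C x"] add: cinner_scaleC_left)

text \<open>\<open>D\<close> is stable under \<open>\<i>\<close> and \<open>A\<close> commutes with
  it, so the real relation tested at \<open>\<i> *\<^sub>C x\<close> supplies the imaginary part of
  the complex one at \<open>x\<close>.\<close>

lemma adjoint_graph_cinner:
  assumes "linear_operator scaleC D A"
  shows "adjoint_graph cinner D A = adjoint_graph inner D A"
  using linear_operator_scaleC[OF assms]
  by (auto simp: adjoint_graph_def cinner_eq_Complex) metis+

lemma linear_operator_scaleR_comp:
  assumes "linear_operator scaleC D A"
  shows "linear_operator scaleC D (\<lambda>x. r *\<^sub>R A x)"
  using assms unfolding linear_operator_def
  by (simp add: scaleC_scaleC mult.commute scaleC_add_right flip: scaleC_of_real)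

lemma ortho_compl_op_graph:
  "ortho_compl ip (op_graph D A) = {(u, v). \<forall>x\<in>D. ip x u + ip (A x) v = 0}"
  by (auto simp: ortho_compl_def prod_ip_def op_graph_def)

lemma ortho_compl_cinner:
  assumes "linear_operator scaleC D A"
  shows "ortho_compl cinner (op_graph D A) = ortho_compl inner (op_graph D A)"
proof -
  have "(\<forall>x\<in>D. cinner x u + cinner (A x) v = 0) \<longleftrightarrow> (\<forall>x\<in>D. inner x u + inner (A x) v = 0)" for u v
  proof (intro iffI ballI)
    fix x assume "\<forall>x\<in>D. cinner x u + cinner (A x) v = 0" "x \<in> D"
    then have "Re (cinner x u + cinner (A x) v) = 0" by simp
    then show "inner x u + inner (A x) v = 0" by (simp add: Re_cinner)
  next
    fix x assume orth: "\<forall>x\<in>D. inner x u + inner (A x) v = 0" and x: "x \<in> D"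
    then have "inner (\<i> *\<^sub>C x) u + inner (\<i> *\<^sub>C A x) v = 0"
      using linear_operator_scaleC[OF assms] by metis
    with orth x show "cinner x u + cinner (A x) v = 0"
      by (simp add: cinner_eq_Complex complex_eq_iff)
  qed
  then show ?thesis by (simp add: ortho_compl_op_graph)
qed

lemma is_operator_closure_complex_imp_real:
  "is_operator_closure scaleC D A E B \<Longrightarrow> is_operator_closure scaleR D A E B"
  by (simp add: is_operator_closure_def linear_operator_complex_imp_real)

lemma op_graph_eqD:
  assumes "op_graph D A = op_graph E B"
  shows "D = E" and "x \<in> D \<Longrightarrow> A x = B x"
proof -
  have "x \<in> D \<and> y = A x \<longleftrightarrow> x \<in> E \<and> y = B x" for x y
    using assms by (metis mem_op_graph)
  then show "D = E" and "x \<in> D \<Longrightarrow> A x = B x" by blast+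
qed

lemma essentially_selfadjoint_complex_iff_real:
  assumes "closable scaleC D A"
  shows "essentially_selfadjoint scaleC cinner D A \<longleftrightarrow> essentially_selfadjoint scaleR inner D A"
proof
  assume "essentially_selfadjoint scaleC cinner D A"
  then obtain E B where EB: "is_operator_closure scaleC D A E B" "selfadjoint_operator cinner E B"
    by (auto simp: essentially_selfadjoint_def)
  then have "selfadjoint_operator inner E B"
    by (simp add: selfadjoint_operator_def is_operator_closure_def adjoint_graph_cinner)
  with is_operator_closure_complex_imp_real[OF EB(1)] show "essentially_selfadjoint scaleR inner D A"
    unfolding essentially_selfadjoint_def by blast
next
  assume "essentially_selfadjoint scaleR inner D A"
  then obtain E B where EB: "is_operator_closure scaleR D A E B" "selfadjoint_operator inner E B"
    by (auto simp: essentially_selfadjoint_def)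
  \<comment> \<open>The real closure \<open>B\<close> is only known to be real linear, and its
    values off \<open>E\<close> are arbitrary. Complex closability supplies a complex linear
    operator with the same graph.\<close>
  obtain E' B' where cl: "is_operator_closure scaleC D A E' B'"
    using assms by (auto simp: closable_def)
  then have gr: "op_graph E B = op_graph E' B'"
    using EB(1) by (simp add: is_operator_closure_def)
  have "adjoint_graph inner E B = adjoint_graph inner E' B'"
    using op_graph_eqD[OF gr] by (simp add: adjoint_graph_def)
  also have "\<dots> = adjoint_graph cinner E' B'"
    using cl by (simp add: adjoint_graph_cinner is_operator_closure_def)
  finally have "selfadjoint_operator cinner E' B'"
    using EB(2) op_graph_eqD(1)[OF gr] gr by (simp add: selfadjoint_operator_def)
  with cl show "essentially_selfadjoint scaleC cinner D A"
    unfolding essentially_selfadjoint_def by blast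
qed

text \<open>\<open>ran_M\<close> and the topology involve only the real structure; selfadjointness
  and orthogonality to the graph were shown to agree for both inner products.\<close>

lemma theorem3p3_complex:
  fixes D :: "'a::{complex_inner, complete_space} set"
  assumes "linear_operator scaleC D A" "closable scaleC D A" "symmetric_operator cinner D A"
  shows "essentially_selfadjoint scaleC cinner D A \<longleftrightarrow>
      (\<exists>c::real. c \<noteq> 0 \<and> closure (ran_M D A c) = UNIV)"
    and "essentially_selfadjoint scaleC cinner D A \<longleftrightarrow>
      (\<exists>c::real. c \<noteq> 0 \<and>
        ortho_compl cinner (op_graph D (\<lambda>x. inverse c *\<^sub>R A x)) \<subseteq> closure (ran_M D A c))"
proof -
  have lin: "linear_operator scaleR D A"
    using assms(1) by (rule linear_operator_complex_imp_real)
  have clos: "closable scaleR D A"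
    using assms(2) is_operator_closure_complex_imp_real unfolding closable_def by blast
  have sym: "symmetric_operator inner D A"
    using assms(3) unfolding symmetric_operator_def by (metis Re_cinner)
  note real = theorem3p3_real[OF lin clos sym]
  show "essentially_selfadjoint scaleC cinner D A \<longleftrightarrow>
      (\<exists>c::real. c \<noteq> 0 \<and> closure (ran_M D A c) = UNIV)"
    unfolding essentially_selfadjoint_complex_iff_real[OF assms(2)] by (rule real(1))
  show "essentially_selfadjoint scaleC cinner D A \<longleftrightarrow>
      (\<exists>c::real. c \<noteq> 0 \<and>
        ortho_compl cinner (op_graph D (\<lambda>x. inverse c *\<^sub>R A x)) \<subseteq> closure (ran_M D A c))"
    unfolding essentially_selfadjoint_complex_iff_real[OF assms(2)]
      ortho_compl_cinner[OF linear_operator_scaleR_comp[OF assms(1)]] by (rule real(2))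
qed

theorem theorem3p3:
  fixes D\<^sub>r :: "'a::{real_inner, complete_space} set" and A\<^sub>r :: "'a \<Rightarrow> 'a"
    and D\<^sub>c :: "'b::{complex_inner, complete_space} set" and A\<^sub>c :: "'b \<Rightarrow> 'b"
  shows
    "(linear_operator scaleR D\<^sub>r A\<^sub>r \<and> closable scaleR D\<^sub>r A\<^sub>r \<and> symmetric_operator inner D\<^sub>r A\<^sub>r \<longrightarrow>
        (essentially_selfadjoint scaleR inner D\<^sub>r A\<^sub>r \<longleftrightarrow>
          (\<exists>c::real. c \<noteq> 0 \<and> closure (ran_M D\<^sub>r A\<^sub>r c) = UNIV)) \<and>
        (essentially_selfadjoint scaleR inner D\<^sub>r A\<^sub>r \<longleftrightarrow>
          (\<exists>c::real. c \<noteq> 0 \<and>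
            ortho_compl inner (op_graph D\<^sub>r (\<lambda>x. inverse c *\<^sub>R A\<^sub>r x)) \<subseteq> closure (ran_M D\<^sub>r A\<^sub>r c))))
     \<and>
     (linear_operator scaleC D\<^sub>c A\<^sub>c \<and> closable scaleC D\<^sub>c A\<^sub>c \<and> symmetric_operator cinner D\<^sub>c A\<^sub>c \<longrightarrow>
        (essentially_selfadjoint scaleC cinner D\<^sub>c A\<^sub>c \<longleftrightarrow>
          (\<exists>c::real. c \<noteq> 0 \<and> closure (ran_M D\<^sub>c A\<^sub>c c) = UNIV)) \<and>
        (essentially_selfadjoint scaleC cinner D\<^sub>c A\<^sub>c \<longleftrightarrow>
          (\<exists>c::real. c \<noteq> 0 \<and>
            ortho_compl cinner (op_graph D\<^sub>c (\<lambda>x. inverse c *\<^sub>R A\<^sub>c x)) \<subseteq> closure (ran_M D\<^sub>c A\<^sub>c c))))"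
  by (intro conjI impI; elim conjE) (rule theorem3p3_real theorem3p3_complex; assumption)+

end
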